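(* Let $q\ge3$ and let $i,j,n$ be integers with $0\le i\le j\le n$ and $i+j\ge n$. Let $f:\Sigma_q^n\to\mathbb{R}$ be a uniform function with $f\in U_{[i,j]}(n,q)$ and $f\not\equiv0$. Then $|f|\ge 2^{n-j}(q-1)^{n-j}q^{i+j-n}$.
   Context: $\Sigma_q=\{0,1,\dots,q-1\}$. The Hamming graph $H(n,q)$ has vertex set $\Sigma_q^n$, two vertices being adjacent iff they differ in exactly one coordinate. A function $f:\Sigma_q^n\to\mathbb{R}$ is a $\lambda$-eigenfunction of $H(n,q)$ if $\lambda f(x)=\sum_{y\text{ adjacent to }x}f(y)$ for all $x$. $\lambda_t(n,q)=n(q-1)-qt$ and $U_t(n,q)$ is the space of $\lambda_t(n,q)$-eigenfunctions; for $i\le j$, $U_{[i,j]}(n,q)=U_i(n,q)\oplus\cdots\oplus U_j(n,q)$. $|f|$ is the number of $x$ with $f(x)\ne0$. For $r\in\{1,\dots,n\}$ and $k\in\Sigma_q$, $f^r_k:\Sigma_q^{n-1}\to\mathbb{R}$ is defined by $f^r_k(y_1,\dots,y_{n-1})=f(y_1,\dots,y_{r-1},k,y_r,\dots,y_{n-1})$. $f$ is called uniform if for every $r\in\{1,\dots,n\}$ there is $l(r)\in\Sigma_q$ such that $f^r_k=f^r_m$ for all $k,m\in\Sigma_q\setminus\{l(r)\}$. *)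

theory Defs
  imports Complex_Main "HOL-Library.NList"
begin

(* A word (x_1,...,x_n) is the list [x_1,...,x_n], with 0-based access by (!).  A function on
   hamming_words n q is a total function on nat list; nothing below depends on its values at
   other lists. *)

definition hamming_words :: "nat \<Rightarrow> nat \<Rightarrow> nat list set" where
  "hamming_words n q = nlists n {..<q}"

definition hamming_adj :: "nat \<Rightarrow> nat \<Rightarrow> nat list \<Rightarrow> nat list \<Rightarrow> bool" where
  "hamming_adj n q x y \<longleftrightarrow>
     x \<in> hamming_words n q \<and> y \<in> hamming_words n q \<and> card {r. r < n \<and> x ! r \<noteq> y ! r} = 1"

definition hamming_eigenfunction :: "nat \<Rightarrow> nat \<Rightarrow> real \<Rightarrow> (nat list \<Rightarrow> real) \<Rightarrow> bool" where
  "hamming_eigenfunction n q c f \<longleftrightarrow>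
     (\<forall>x \<in> hamming_words n q. c * f x = (\<Sum>y | hamming_adj n q x y. f y))"

definition hamming_eigenvalue :: "nat \<Rightarrow> nat \<Rightarrow> nat \<Rightarrow> real" where
  "hamming_eigenvalue t n q = real n * (real q - 1) - real q * real t"

definition U :: "nat \<Rightarrow> nat \<Rightarrow> nat \<Rightarrow> (nat list \<Rightarrow> real) set" where
  "U t n q = {f. hamming_eigenfunction n q (hamming_eigenvalue t n q) f}"

(* The sum of the spaces U t n q for i \<le> t \<le> j.  It is direct for q > 0 because the
   eigenvalues are then pairwise distinct. *)
definition U_interval :: "nat \<Rightarrow> nat \<Rightarrow> nat \<Rightarrow> nat \<Rightarrow> (nat list \<Rightarrow> real) set" where
  "U_interval i j n q =
     {f. \<exists>g. (\<forall>t \<in> {i..j}. g t \<in> U t n q) \<and>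
             (\<forall>x \<in> hamming_words n q. f x = (\<Sum>t = i..j. g t x))}"

definition supp_size :: "nat \<Rightarrow> nat \<Rightarrow> (nat list \<Rightarrow> real) \<Rightarrow> nat" where
  "supp_size n q f = card {x \<in> hamming_words n q. f x \<noteq> 0}"

(* Inserts k so that it becomes the r-th letter, counted from 1. *)
definition slice :: "nat \<Rightarrow> nat \<Rightarrow> (nat list \<Rightarrow> real) \<Rightarrow> nat list \<Rightarrow> real" where
  "slice r k f y = f (take (r - 1) y @ k # drop (r - 1) y)"

definition uniform_fun :: "nat \<Rightarrow> nat \<Rightarrow> (nat list \<Rightarrow> real) \<Rightarrow> bool" where
  "uniform_fun n q f \<longleftrightarrow>
     (\<forall>r \<in> {1..n}. \<exists>l \<in> {..<q}. \<forall>k \<in> {..<q} - {l}. \<forall>m \<in> {..<q} - {l}.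
        \<forall>y \<in> hamming_words (n - 1) q. slice r k f y = slice r m f y)"

end

theory Submission
  imports Defs
begin

text \<open>
  Write \<open>a = n - j\<close>. A uniform function has, along the first coordinate, only two slices \<open>A\<close>
  (taken once) and \<open>B\<close> (taken \<open>q - 1\<close> times), so its support has size \<open>|A| + (q - 1) |B|\<close>. If its
  spectrum is bounded below by \<open>i\<close> and above by \<open>n - a\<close>, then \<open>A + (q - 1) B\<close> has parameters
  \<open>(i, a - 1)\<close>, \<open>A - B\<close> has parameters \<open>(i - 1, a)\<close> and \<open>A\<close>, \<open>B\<close> have parameters \<open>(i - 1, a - 1)\<close>
  in dimension \<open>n - 1\<close>. Induction on \<open>n\<close> then gives the bound
  \<open>(2 (q - 1))^min(i,a) q^|i - a|\<close> for all \<open>i\<close> and \<open>a\<close>; the restriction \<open>i \<ge> a\<close> would not survive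
  the induction. When \<open>A\<close>, \<open>B\<close>, \<open>A - B\<close> and \<open>A + (q - 1) B\<close> are all nonzero, \<open>|A| + |B|\<close> is at least the
  support size of either combination, which yields the factor \<open>q + (q - 2) = 2 (q - 1)\<close>.
\<close>

section \<open>Splitting words, adjacency and neighbour sums by the first letter\<close>

lemma hamming_words_0 [simp]: "hamming_words 0 q = {[]}"
  by (simp add: hamming_words_def)

lemma hamming_words_Suc:
  "hamming_words (Suc n) q = (\<lambda>(k, y). k # y) ` ({..<q} \<times> hamming_words n q)"
  by (auto simp: hamming_words_def nlists_Suc)

lemma Cons_in_hamming_words [simp]:
  "k # y \<in> hamming_words (Suc n) q \<longleftrightarrow> k < q \<and> y \<in> hamming_words n q"
  by (auto simp: hamming_words_Suc)

lemma finite_hamming_words [simp]: "finite (hamming_words n q)"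
  by (induction n) (auto simp: hamming_words_Suc)

lemma length_hamming_words: "x \<in> hamming_words n q \<Longrightarrow> length x = n"
  by (simp add: hamming_words_def)

lemma hamming_adj_Cons:
  "hamming_adj (Suc n) q (k # y) (m # z) \<longleftrightarrow>
     k < q \<and> m < q \<and>
     (k = m \<and> hamming_adj n q y z \<or> k \<noteq> m \<and> y = z \<and> y \<in> hamming_words n q)"
proof -
  let ?D = "{r. r < n \<and> y ! r \<noteq> z ! r}"
  have "{r. r < Suc n \<and> (k # y) ! r \<noteq> (m # z) ! r} = (if k = m then {} else {0}) \<union> Suc ` ?D"
    by (auto simp: less_Suc_eq_0_disj)
  then have card: "card {r. r < Suc n \<and> (k # y) ! r \<noteq> (m # z) ! r}
      = (if k = m then 0 else 1) + card ?D"
    by (auto simp: card_insert_if card_image)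
  have "card ?D = 0 \<longleftrightarrow> y = z" if "y \<in> hamming_words n q" "z \<in> hamming_words n q"
    using that by (auto simp: length_hamming_words intro!: nth_equalityI)
  then show ?thesis
    unfolding hamming_adj_def card by auto
qed

text \<open>The graph is the Cartesian product of a complete graph on the first letters with the
  Hamming graph on the tails, so a neighbour changes either the tail or the first letter. The full
  sum over \<open>m\<close> also counts \<open>m = k\<close>, hence the correction
  \<open>- f (k # y)\<close>.\<close>

lemma sum_hamming_adj_Cons:
  assumes "k < q" "y \<in> hamming_words n q"
  shows "(\<Sum>x | hamming_adj (Suc n) q (k # y) x. f x)
    = (\<Sum>z | hamming_adj n q y z. f (k # z)) + (\<Sum>m<q. f (m # y)) - (f (k # y) :: real)"
proof -
  let ?Z = "{z. hamming_adj n q y z}"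
  have fin: "finite ?Z"
    by (rule finite_subset[of _ "hamming_words n q"]) (auto simp: hamming_adj_def)
  have "{x. hamming_adj (Suc n) q (k # y) x} = (#) k ` ?Z \<union> (\<lambda>m. m # y) ` ({..<q} - {k})"
    (is "?L = ?R")
  proof (rule set_eqI)
    fix x
    show "x \<in> ?L \<longleftrightarrow> x \<in> ?R"
    proof (cases x)
      case Nil
      then show ?thesis by (auto simp: hamming_adj_def dest: length_hamming_words)
    next
      case (Cons m z)
      then show ?thesis using assms by (auto simp: hamming_adj_Cons)
    qed
  qed
  then have "(\<Sum>x | hamming_adj (Suc n) q (k # y) x. f x)
      = sum f ((#) k ` ?Z) + sum f ((\<lambda>m. m # y) ` ({..<q} - {k}))"
    using fin by (simp only:) (rule sum.union_disjoint, auto)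
  also have "sum f ((#) k ` ?Z) = (\<Sum>z\<in>?Z. f (k # z))"
    by (simp add: sum.reindex)
  also have "sum f ((\<lambda>m. m # y) ` ({..<q} - {k})) = (\<Sum>m\<in>{..<q} - {k}. f (m # y))"
    by (simp add: sum.reindex inj_on_def)
  also have "\<dots> = (\<Sum>m<q. f (m # y)) - f (k # y)"
    using assms by (simp add: sum_diff1)
  finally show ?thesis by simp
qed

section \<open>Spectral support, described by recursion on the length of words\<close>

text \<open>
  \<open>spectral q n i a f\<close> says that the part of \<open>f\<close> outside \<open>U_[i, n - a]\<close> vanishes. The truncated
  subtractions are intended: a lower bound \<open>-1\<close> and an upper bound \<open>n + 1\<close> are no constraints.
\<close>

fun spectral :: "nat \<Rightarrow> nat \<Rightarrow> nat \<Rightarrow> nat \<Rightarrow> (nat list \<Rightarrow> real) \<Rightarrow> bool" where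
  "spectral q 0 i a f \<longleftrightarrow> i = 0 \<and> a = 0 \<or> f [] = 0"
| "spectral q (Suc n) i a f \<longleftrightarrow>
     spectral q n i (a - 1) (\<lambda>y. \<Sum>k<q. f (k # y)) \<and>
     (\<forall>k<q. \<forall>m<q. spectral q n (i - 1) a (\<lambda>y. f (k # y) - f (m # y)))"

lemma spectral_cong:
  "(\<And>x. x \<in> hamming_words n q \<Longrightarrow> f x = g x) \<Longrightarrow> spectral q n i a f \<longleftrightarrow> spectral q n i a g"
proof (induction n arbitrary: i a f g)
  case (Suc n)
  have "spectral q n i (a - 1) (\<lambda>y. \<Sum>k<q. f (k # y))
      \<longleftrightarrow> spectral q n i (a - 1) (\<lambda>y. \<Sum>k<q. g (k # y))"
    using Suc.prems by (intro Suc.IH sum.cong) auto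
  moreover have "spectral q n (i - 1) a (\<lambda>y. f (k # y) - f (m # y))
      \<longleftrightarrow> spectral q n (i - 1) a (\<lambda>y. g (k # y) - g (m # y))" if "k < q" "m < q" for k m
    using Suc.prems that by (intro Suc.IH) auto
  ultimately show ?case by auto
qed simp

lemma spectral_zero: "spectral q n i a (\<lambda>_. 0)"
  by (induction n arbitrary: i a) auto

lemma spectral_linear:
  "spectral q n i a f \<Longrightarrow> spectral q n i a g \<Longrightarrow> spectral q n i a (\<lambda>x. c * f x + d * g x)"
proof (induction n arbitrary: i a f g)
  case (Suc n)
  have "spectral q n i (a - 1) (\<lambda>y. \<Sum>k<q. c * f (k # y) + d * g (k # y))"
    using Suc.IH[of i "a - 1" "\<lambda>y. \<Sum>k<q. f (k # y)" "\<lambda>y. \<Sum>k<q. g (k # y)"] Suc.prems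
    by (simp add: sum.distrib sum_distrib_left)
  moreover have "spectral q n (i - 1) a
      (\<lambda>y. c * f (k # y) + d * g (k # y) - (c * f (m # y) + d * g (m # y)))"
    if "k < q" "m < q" for k m
    using Suc.IH[of "i - 1" a "\<lambda>y. f (k # y) - f (m # y)" "\<lambda>y. g (k # y) - g (m # y)"]
      Suc.prems that
    by (simp add: algebra_simps)
  ultimately show ?case by simp
qed auto

lemma spectral_scale: "spectral q n i a f \<Longrightarrow> spectral q n i a (\<lambda>x. c * f x)"
  using spectral_linear[of q n i a f f c 0] by simp

lemma spectral_sum:
  assumes "finite T" "\<And>t. t \<in> T \<Longrightarrow> spectral q n i a (g t)"
  shows "spectral q n i a (\<lambda>x. \<Sum>t\<in>T. g t x)"
  using assms
proof (induction T rule: finite_induct)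
  case (insert t T)
  then show ?case
    using spectral_linear[of q n i a "g t" "\<lambda>x. \<Sum>t\<in>T. g t x" 1 1] by simp
qed (simp add: spectral_zero)

lemma spectral_antimono:
  "spectral q n i a f \<Longrightarrow> i' \<le> i \<Longrightarrow> a' \<le> a \<Longrightarrow> spectral q n i' a' f"
proof (induction n arbitrary: i i' a a' f)
  case (Suc n)
  then show ?case
    by (auto intro: Suc.IH[of i "a - 1"] Suc.IH[of "i - 1" a] diff_le_mono)
qed auto

text \<open>Both recursive clauses only take truncated predecessors of the parameters, and these
  commute with \<open>max\<close>. This merges two constraints on the same slice.\<close>

lemma spectral_max:
  "spectral q n i a f \<Longrightarrow> spectral q n i' a' f \<Longrightarrow> spectral q n (max i i') (max a a') f"
proof (induction n arbitrary: i i' a a' f)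
  case (Suc n)
  have "max a a' - 1 = max (a - 1) (a' - 1)" "max i i' - 1 = max (i - 1) (i' - 1)"
    by auto
  with Suc show ?case by simp
qed auto

text \<open>
  Indices \<open>t\<close> outside \<open>{0..n}\<close> are admitted because the slices of an eigenfunction may have the
  formal indices \<open>-1\<close> and \<open>n + 1\<close>; such eigenfunctions are in fact zero.
\<close>

lemma spectral_eigenfunction:
  fixes t :: int
  assumes "q > 0"
    and "hamming_eigenfunction n q (real n * (real q - 1) - real q * of_int t) f"
    and "int i \<le> t \<or> t < 0" and "t + int a \<le> int n \<or> t > int n"
  shows "spectral q n i a f"
  using assms(2-)
proof (induction n arbitrary: i a t f)
  case 0
  \<comment> \<open>The graph on the single word \<open>[]\<close> has no edges, so the eigenvalue
    equation forces \<open>t = 0\<close> or \<open>f [] = 0\<close>; for \<open>t = 0\<close> the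
    bounds give \<open>i = 0\<close> and \<open>a = 0\<close>.\<close>
  have "card {r. r < 0 \<and> P r} = 0" for P :: "nat \<Rightarrow> bool" by simp
  then have "real q * of_int t * f [] = 0"
    using 0(1) by (simp add: hamming_eigenfunction_def hamming_adj_def)
  then show ?case using 0 \<open>q > 0\<close> by auto
next
  case (Suc n)
  let ?c = "real (Suc n) * (real q - 1) - real q * of_int t"
  let ?S = "\<lambda>y. \<Sum>k<q. f (k # y)"
  have eig: "?c * f (k # y) = (\<Sum>z | hamming_adj n q y z. f (k # z)) + ?S y - f (k # y)"
    if "k < q" "y \<in> hamming_words n q" for k y
  proof -
    have "?c * f (k # y) = (\<Sum>x | hamming_adj (Suc n) q (k # y) x. f x)"
      using Suc.prems(1) that by (simp add: hamming_eigenfunction_def del: of_nat_Suc)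
    then show ?thesis using sum_hamming_adj_Cons[OF that, of f] by simp
  qed
  \<comment> \<open>Summation over the first letter lowers the eigenvalue by \<open>q - 1\<close>:
    the index \<open>t\<close> stays while \<open>n\<close> drops, so the distance from the top
    index shrinks by one.\<close>
  have "hamming_eigenfunction n q (real n * (real q - 1) - real q * of_int t) ?S"
    unfolding hamming_eigenfunction_def
  proof
    fix y assume y: "y \<in> hamming_words n q"
    have "?c * ?S y = (\<Sum>k<q. (\<Sum>z | hamming_adj n q y z. f (k # z)) + ?S y - f (k # y))"
      unfolding sum_distrib_left by (rule sum.cong) (use eig y in auto)
    also have "\<dots> = (\<Sum>z | hamming_adj n q y z. ?S z) + real q * ?S y - ?S y"
      by (simp add: sum.distrib sum_subtractf sum.swap[of "\<lambda>k z. f (k # z)"])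
    finally show "(real n * (real q - 1) - real q * of_int t) * ?S y
        = (\<Sum>z | hamming_adj n q y z. ?S z)"
      by (simp add: algebra_simps)
  qed
  then have "spectral q n i (a - 1) ?S"
    by (rule Suc.IH) (use Suc.prems in auto)
  \<comment> \<open>In a difference of slices the term \<open>?S\<close> cancels and the eigenvalue
    rises by 1, which is index \<open>t - 1\<close> in dimension \<open>n\<close>; the distance from
    the top index is kept.\<close>
  moreover have "spectral q n (i - 1) a (\<lambda>y. f (k # y) - f (m # y))" if "k < q" "m < q" for k m
  proof (rule Suc.IH)
    show "hamming_eigenfunction n q (real n * (real q - 1) - real q * of_int (t - 1))
        (\<lambda>y. f (k # y) - f (m # y))"
      unfolding hamming_eigenfunction_def
    proof
      fix y assume y: "y \<in> hamming_words n q"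
      show "(real n * (real q - 1) - real q * of_int (t - 1)) * (f (k # y) - f (m # y))
          = (\<Sum>z | hamming_adj n q y z. f (k # z) - f (m # z))"
        using eig[OF that(1) y] eig[OF that(2) y] by (simp add: sum_subtractf algebra_simps)
    qed
  qed (use Suc.prems in auto)
  ultimately show ?case by simp
qed

lemma spectral_U_interval:
  assumes "q > 0" "j \<le> n" "f \<in> U_interval i j n q"
  shows "spectral q n i (n - j) f"
proof -
  obtain g where g: "\<forall>t \<in> {i..j}. g t \<in> U t n q"
    and f: "\<forall>x \<in> hamming_words n q. f x = (\<Sum>t = i..j. g t x)"
    using assms(3) by (auto simp: U_interval_def)
  have "spectral q n i (n - j) (g t)" if "t \<in> {i..j}" for t
    using spectral_eigenfunction[of q n "int t" "g t" i "n - j"] g that assms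
    by (auto simp: U_def hamming_eigenvalue_def)
  then have "spectral q n i (n - j) (\<lambda>x. \<Sum>t = i..j. g t x)"
    by (intro spectral_sum) auto
  then show ?thesis
    using spectral_cong[of n q f "\<lambda>x. \<Sum>t = i..j. g t x"] f by auto
qed

section \<open>Slices of uniform functions\<close>

text \<open>The exceptional letter of \<open>f\<close> at a later coordinate does not depend on the
  first letter, so both slices share it. Unrelated uniform functions may have different exceptional
  letters, and their combinations need not be uniform.\<close>

lemma uniform_fun_Cons_linear:
  assumes "uniform_fun (Suc n) q f" "m < q" "m' < q"
  shows "uniform_fun n q (\<lambda>y. c * f (m # y) + d * f (m' # y))"
  unfolding uniform_fun_def
proof
  fix r assume "r \<in> {1..n}"
  then obtain s n' where r: "r = Suc s" and n: "n = Suc n'"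
    by (cases r; cases n) auto
  have "Suc r \<in> {1..Suc n}" using \<open>r \<in> {1..n}\<close> by simp
  then obtain l where l: "l \<in> {..<q}"
    and *: "\<And>k k' y. k \<in> {..<q} - {l} \<Longrightarrow> k' \<in> {..<q} - {l} \<Longrightarrow> y \<in> hamming_words n q \<Longrightarrow>
              slice (Suc r) k f y = slice (Suc r) k' f y"
    using assms(1) unfolding uniform_fun_def by (metis diff_Suc_1)
  have "slice r k (\<lambda>y. c * f (m # y) + d * f (m' # y)) y
      = slice r k' (\<lambda>y. c * f (m # y) + d * f (m' # y)) y"
    if "k \<in> {..<q} - {l}" "k' \<in> {..<q} - {l}" "y \<in> hamming_words (n - 1) q" for k k' y
    using *[OF that(1,2), of "m # y"] *[OF that(1,2), of "m' # y"] that(3) assms(2,3)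
    by (simp add: r n slice_def)
  with l show "\<exists>l\<in>{..<q}. \<forall>k\<in>{..<q} - {l}. \<forall>k'\<in>{..<q} - {l}. \<forall>y\<in>hamming_words (n - 1) q.
      slice r k (\<lambda>y. c * f (m # y) + d * f (m' # y)) y
        = slice r k' (\<lambda>y. c * f (m # y) + d * f (m' # y)) y"
    by blast
qed

lemma uniform_fun_SucE:
  assumes "uniform_fun (Suc n) q f"
  obtains l where "l < q"
    "\<And>k m y. k < q \<Longrightarrow> k \<noteq> l \<Longrightarrow> m < q \<Longrightarrow> m \<noteq> l \<Longrightarrow> y \<in> hamming_words n q \<Longrightarrow>
       f (k # y) = f (m # y)"
proof -
  have "\<exists>l\<in>{..<q}. \<forall>k\<in>{..<q} - {l}. \<forall>m\<in>{..<q} - {l}. \<forall>y\<in>hamming_words n q.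
      slice 1 k f y = slice 1 m f y"
    using assms unfolding uniform_fun_def by (elim ballE[of _ _ 1]) auto
  then show ?thesis
    using that unfolding slice_def by auto
qed

section \<open>Support sizes of combinations and slices\<close>

lemma supp_size_cong:
  "(\<And>x. x \<in> hamming_words n q \<Longrightarrow> f x = 0 \<longleftrightarrow> g x = 0) \<Longrightarrow> supp_size n q f = supp_size n q g"
  unfolding supp_size_def by (rule arg_cong[of _ _ card]) auto

lemma supp_size_linear_le:
  "supp_size n q (\<lambda>x. c * f x + d * g x) \<le> supp_size n q f + supp_size n q g"
proof -
  let ?N = "\<lambda>h. {x \<in> hamming_words n q. h x \<noteq> (0::real)}"
  have "card (?N (\<lambda>x. c * f x + d * g x)) \<le> card (?N f \<union> ?N g)"
    by (rule card_mono) auto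
  also have "\<dots> \<le> card (?N f) + card (?N g)"
    by (rule card_Un_le)
  finally show ?thesis by (simp add: supp_size_def)
qed

lemma supp_size_Suc:
  "supp_size (Suc n) q f = (\<Sum>k<q. supp_size n q (\<lambda>y. f (k # y)))"
proof -
  have "{x \<in> hamming_words (Suc n) q. f x \<noteq> 0}
      = (\<lambda>(k, y). k # y) ` (SIGMA k:{..<q}. {y \<in> hamming_words n q. f (k # y) \<noteq> 0})"
    by (auto simp: hamming_words_Suc)
  then show ?thesis
    unfolding supp_size_def by (simp add: card_image inj_on_def)
qed

section \<open>Arithmetic of the lower bound\<close>

definition supp_bound :: "nat \<Rightarrow> nat \<Rightarrow> nat \<Rightarrow> nat" where
  "supp_bound q i a = (2 * (q - 1)) ^ min i a * q ^ (max i a - min i a)"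

lemma supp_bound_commute: "supp_bound q i a = supp_bound q a i"
  by (simp add: supp_bound_def min.commute max.commute)

text \<open>For \<open>i > a\<close> this is an equality. For \<open>0 < i \<le> a\<close> it
  reduces to \<open>2 * (q - 1) \<le> q * q\<close>, where the difference of the two sides is
  \<open>(q - 1)\<close> squared plus 1. It serves the cases in which all \<open>q\<close> slices
  have equally large support.\<close>

lemma supp_bound_pred_le:
  assumes "q > 0"
  shows "supp_bound q i a \<le> q * supp_bound q (i - 1) a"
proof (cases "i \<le> a")
  case False
  then obtain d where "i = Suc (a + d)"
    using less_imp_Suc_add[of a i] by auto
  then show ?thesis by (simp add: supp_bound_def)
next
  case True
  show ?thesis
  proof (cases i)
    case 0
    then show ?thesis using assms by (simp add: supp_bound_def)
  next
    case (Suc i')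
    with True obtain d where a: "a = Suc (i' + d)"
      using le_Suc_ex[of i a] by auto
    have "0 \<le> (int q - 1)\<^sup>2 + 1" by simp
    then have "2 * (int q - 1) \<le> int q * int q"
      by (simp add: power2_eq_square algebra_simps)
    then have "int (2 * (q - 1)) \<le> int (q * q)"
      using assms by (simp add: of_nat_diff)
    then have "2 * (q - 1) \<le> q * q" by (simp only: of_nat_le_iff)
    then have "2 * (q - 1) * ((2 * (q - 1)) ^ i' * q ^ d) \<le> q * q * ((2 * (q - 1)) ^ i' * q ^ d)"
      by (rule mult_le_mono1)
    then show ?thesis
      unfolding supp_bound_def Suc a by (simp add: ac_simps)
  qed
qed

lemma supp_bound_Suc_Suc: "supp_bound q (Suc i) (Suc a) = 2 * (q - 1) * supp_bound q i a"
  by (simp add: supp_bound_def)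

lemma supp_bound_Suc_le: "a \<le> i \<Longrightarrow> supp_bound q (Suc i) a = q * supp_bound q i a"
  by (simp add: supp_bound_def Suc_diff_le)

section \<open>The induction on the number of coordinates\<close>

theorem supp_size_uniform_ge:
  assumes "q \<ge> 2"
  shows "spectral q n i a f \<Longrightarrow> uniform_fun n q f \<Longrightarrow> \<exists>x \<in> hamming_words n q. f x \<noteq> 0 \<Longrightarrow>
    supp_bound q i a \<le> supp_size n q f"
proof (induction n arbitrary: i a f)
  case 0
  then have "{x \<in> hamming_words 0 q. f x \<noteq> 0} = {[]}" by auto
  then show ?case using 0 by (simp add: supp_size_def supp_bound_def)
next
  case (Suc n)
  obtain l where l: "l < q" and uni:
    "\<And>k m y. k < q \<Longrightarrow> k \<noteq> l \<Longrightarrow> m < q \<Longrightarrow> m \<noteq> l \<Longrightarrow> y \<in> hamming_words n q \<Longrightarrow>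
       f (k # y) = f (m # y)"
    using uniform_fun_SucE[OF Suc.prems(2)] by blast
  obtain m where m: "m < q" "m \<noteq> l"
    using assms by (intro that[of "if l = 0 then 1 else 0"]) auto
  define A where "A = (\<lambda>y. f (l # y))"
  define B where "B = (\<lambda>y. f (m # y))"
  define S where "S = (\<lambda>y. A y + (real q - 1) * B y)"
  let ?zero = "\<lambda>g. \<forall>y \<in> hamming_words n q. g y = (0::real)"
  have fB: "f (k # y) = B y" if "k \<in> {..<q} - {l}" "y \<in> hamming_words n q" for k y
    unfolding B_def using that by (intro uni m) auto
  have S: "(\<Sum>k<q. f (k # y)) = S y" if y: "y \<in> hamming_words n q" for y
  proof -
    have "(\<Sum>k<q. f (k # y)) = A y + (\<Sum>k\<in>{..<q} - {l}. f (k # y))"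
      using l by (simp add: sum.remove A_def)
    also have "(\<Sum>k\<in>{..<q} - {l}. f (k # y)) = (\<Sum>k\<in>{..<q} - {l}. B y)"
      by (intro sum.cong refl fB y)
    finally show ?thesis using l by (simp add: S_def of_nat_diff)
  qed
  have size: "supp_size (Suc n) q f = supp_size n q A + (q - 1) * supp_size n q B"
  proof -
    have "supp_size (Suc n) q f
        = supp_size n q A + (\<Sum>k\<in>{..<q} - {l}. supp_size n q (\<lambda>y. f (k # y)))"
      using l by (simp add: supp_size_Suc sum.remove A_def)
    also have "(\<Sum>k\<in>{..<q} - {l}. supp_size n q (\<lambda>y. f (k # y)))
        = (\<Sum>k\<in>{..<q} - {l}. supp_size n q B)"
      by (intro sum.cong refl supp_size_cong) (simp only: fB)
    finally show ?thesis using l by simp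
  qed
  \<comment> \<open>\<open>p = q - 2\<close> counts the copies of \<open>B\<close> that remain after
    one copy is paired with \<open>A\<close>.\<close>
  obtain p where p: "q = Suc (Suc p)"
    using assms by (metis add_2_eq_Suc le_Suc_ex)
  have size': "supp_size (Suc n) q f
      = supp_size n q A + supp_size n q B + p * supp_size n q B"
    using size by (simp add: p)
  have size_ge: "supp_size n q A \<le> supp_size (Suc n) q f"
    "supp_size n q B \<le> supp_size (Suc n) q f"
    by (auto simp: size')
  have uniform: "uniform_fun n q (\<lambda>y. c * A y + d * B y)" for c d
    unfolding A_def B_def by (rule uniform_fun_Cons_linear[OF Suc.prems(2) l m(1)])
  have specS: "spectral q n i (a - 1) S"
    using Suc.prems(1) spectral_cong[of n q "\<lambda>y. \<Sum>k<q. f (k # y)" S] S by simp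
  have specD: "spectral q n (i - 1) a (\<lambda>y. A y - B y)"
    using Suc.prems(1) l m by (simp add: A_def B_def)
  have scaled: "spectral q n i' a' h"
    if "spectral q n i' a' g" "\<And>y. y \<in> hamming_words n q \<Longrightarrow> h y = c * g y" for i' a' g h c
    using spectral_scale[OF that(1), of c] spectral_cong[of n q h "\<lambda>y. c * g y"] that(2) by simp
  have nz: "\<not> (?zero A \<and> ?zero B)"
  proof
    assume zero: "?zero A \<and> ?zero B"
    obtain k y where ky: "k < q" "y \<in> hamming_words n q" "f (k # y) \<noteq> 0"
      using Suc.prems(3) by (auto simp: hamming_words_Suc)
    then have "f (k # y) = A y \<or> f (k # y) = B y"
      using fB by (cases "k = l") (auto simp: A_def)
    with zero ky show False by auto
  qed
  have q1: "real q - 1 \<noteq> 0" using assms by simp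
  \<comment> \<open>The induction hypothesis needs nonzero functions, so the vanishing of each of
    the four combinations is treated separately.\<close>
  consider (A) "?zero A" | (B) "?zero B" | (D) "?zero (\<lambda>y. A y - B y)" "\<not> ?zero A"
    | (S) "?zero S" "\<not> ?zero A"
    | (generic) "\<not> ?zero A" "\<not> ?zero B" "\<not> ?zero (\<lambda>y. A y - B y)" "\<not> ?zero S"
    by blast
  then show ?case
  proof cases
    case A
    \<comment> \<open>With \<open>A = 0\<close>, both \<open>S\<close> and \<open>A - B\<close> are
      nonzero multiples of \<open>B\<close>, so \<open>B\<close> inherits both constraints and hence
      the full parameters \<open>i\<close> and \<open>a\<close>.\<close>
    have "spectral q n i (a - 1) B"
      by (rule scaled[OF specS, of _ "1 / (real q - 1)"]) (use A q1 in \<open>simp add: S_def\<close>)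
    moreover have "spectral q n (i - 1) a B"
      by (rule scaled[OF specD, of _ "- 1"]) (use A in simp)
    ultimately have "spectral q n i a B"
      using spectral_max[of q n i "a - 1" B "i - 1" a] by (simp add: max_absorb1 max_absorb2)
    then have "supp_bound q i a \<le> supp_size n q B"
      by (rule Suc.IH) (use uniform[of 0 1] nz A in auto)
    then show ?thesis using size_ge(2) by linarith
  next
    case B
    have "spectral q n i (a - 1) A"
      by (rule scaled[OF specS, of _ 1]) (use B in \<open>simp add: S_def\<close>)
    moreover have "spectral q n (i - 1) a A"
      by (rule scaled[OF specD, of _ 1]) (use B in simp)
    ultimately have "spectral q n i a A"
      using spectral_max[of q n i "a - 1" A "i - 1" a] by (simp add: max_absorb1 max_absorb2)
    then have "supp_bound q i a \<le> supp_size n q A"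
      by (rule Suc.IH) (use uniform[of 1 0] nz B in auto)
    then show ?thesis using size_ge(1) by linarith
  next
    case D
    \<comment> \<open>Equal slices give \<open>S = q A\<close>, so \<open>A\<close> inherits the
      parameters of \<open>S\<close>.\<close>
    have "spectral q n i (a - 1) A"
      by (rule scaled[OF specS, of _ "1 / real q"])
        (use D assms in \<open>simp add: S_def field_simps\<close>)
    then have "supp_bound q i (a - 1) \<le> supp_size n q A"
      by (rule Suc.IH) (use uniform[of 1 0] D in auto)
    moreover have "supp_size n q B = supp_size n q A"
      by (rule supp_size_cong) (use D in auto)
    then have "supp_size (Suc n) q f = q * supp_size n q A"
      using size by (simp add: p)
    moreover have "supp_bound q i a \<le> q * supp_bound q i (a - 1)"
      using supp_bound_pred_le[of q a i] assms by (simp add: supp_bound_commute)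
    ultimately show ?thesis by (metis mult_le_mono2 le_trans)
  next
    case S
    have AB: "A y = - ((real q - 1) * B y)" if "y \<in> hamming_words n q" for y
      using bspec[OF S(1) that] unfolding S_def by linarith
    \<comment> \<open>From \<open>A = - (q - 1) B\<close> follows
      \<open>A - B = (q / (q - 1)) A\<close>, so \<open>A\<close> inherits the parameters of
      \<open>A - B\<close>.\<close>
    have "spectral q n (i - 1) a A"
      by (rule scaled[OF specD, of _ "(real q - 1) / real q"])
        (use AB assms in \<open>simp add: field_simps\<close>)
    then have "supp_bound q (i - 1) a \<le> supp_size n q A"
      by (rule Suc.IH) (use uniform[of 1 0] S in auto)
    moreover have "supp_size n q B = supp_size n q A"
      by (rule supp_size_cong) (use AB q1 in auto)
    then have "supp_size (Suc n) q f = q * supp_size n q A"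
      using size by (simp add: p)
    moreover have "supp_bound q i a \<le> q * supp_bound q (i - 1) a"
      using supp_bound_pred_le[of q i a] assms by simp
    ultimately show ?thesis by (metis mult_le_mono2 le_trans)
  next
    case generic
    let ?b = "supp_bound q (i - 1) (a - 1)"
    have specS': "spectral q n (i - 1) (a - 1) S"
      and specD': "spectral q n (i - 1) (a - 1) (\<lambda>y. A y - B y)"
      using spectral_antimono[OF specS] spectral_antimono[OF specD] by auto
    \<comment> \<open>The slices are recovered from \<open>q A = S + (q - 1) (A - B)\<close> and
      \<open>q B = S - (A - B)\<close>.\<close>
    have "spectral q n (i - 1) (a - 1) A"
      using spectral_linear[OF specS' specD', of "1 / real q" "(real q - 1) / real q"] assms
      by (elim scaled[where c = 1]) (simp add: S_def field_simps)
    then have bA: "?b \<le> supp_size n q A"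
      by (rule Suc.IH) (use uniform[of 1 0] generic in auto)
    have "spectral q n (i - 1) (a - 1) B"
      using spectral_linear[OF specS' specD', of "1 / real q" "- 1 / real q"] assms
      by (elim scaled[where c = 1]) (simp add: S_def field_simps)
    then have bB: "?b \<le> supp_size n q B"
      by (rule Suc.IH) (use uniform[of 0 1] generic in auto)
    show ?thesis
    proof (cases "i = 0 \<or> a = 0")
      \<comment> \<open>By truncation at most one of \<open>i\<close> and \<open>a\<close> really
        decreases, so a single factor \<open>q\<close> makes up for the loss, and the
        \<open>q\<close> slices supply it.\<close>
      case True
      have "supp_bound q i a \<le> q * ?b"
        using supp_bound_pred_le[of q i a] supp_bound_pred_le[of q a i] True assms
        by (auto simp: supp_bound_commute)
      also have "\<dots> = ?b + ?b + p * ?b" by (simp add: p)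
      also have "\<dots> \<le> supp_size (Suc n) q f"
        unfolding size' using bA bB by (intro add_mono mult_le_mono2)
      finally show ?thesis .
    next
      case False
      then obtain i' a' where Suc': "i = Suc i'" "a = Suc a'"
        by (metis not0_implies_Suc)
      have "supp_bound q i (a - 1) \<le> supp_size n q S"
        using specS by (rule Suc.IH) (use uniform[of 1 "real q - 1"] generic in \<open>auto simp: S_def\<close>)
      moreover have "supp_size n q S \<le> supp_size n q A + supp_size n q B"
        using supp_size_linear_le[of n q 1 A "real q - 1" B] by (simp add: S_def)
      moreover have "supp_bound q (i - 1) a \<le> supp_size n q (\<lambda>y. A y - B y)"
        using specD by (rule Suc.IH) (use uniform[of 1 "- 1"] generic in auto)
      moreover have "supp_size n q (\<lambda>y. A y - B y) \<le> supp_size n q A + supp_size n q B"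
        using supp_size_linear_le[of n q 1 A "- 1" B] by simp
      \<comment> \<open>Lowering only the smaller of \<open>i\<close> and \<open>a\<close> gives
        \<open>q * ?b\<close>: the bound for \<open>S\<close> serves when \<open>a \<le> i\<close>,
        that for \<open>A - B\<close> otherwise.\<close>
      moreover have "q * ?b = supp_bound q i (a - 1) \<or> q * ?b = supp_bound q (i - 1) a"
        using supp_bound_Suc_le[of a' i' q] supp_bound_Suc_le[of i' a' q]
        by (cases "a' \<le> i'") (auto simp: Suc' supp_bound_commute)
      ultimately have "q * ?b \<le> supp_size n q A + supp_size n q B" by linarith
      moreover have "p * ?b \<le> p * supp_size n q B" using bB by simp
      moreover have "supp_bound q i a = q * ?b + p * ?b"
        by (simp add: Suc' supp_bound_Suc_Suc p algebra_simps)
      ultimately show ?thesis unfolding size' by linarith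
    qed
  qed
qed

theorem theorem2:
  fixes q i j n :: nat and f :: "nat list \<Rightarrow> real"
  assumes "q \<ge> 3"
    and "i \<le> j" and "j \<le> n" and "i + j \<ge> n"
    and "uniform_fun n q f"
    and "f \<in> U_interval i j n q"
    and "\<exists>x \<in> hamming_words n q. f x \<noteq> 0"
  shows "supp_size n q f \<ge> 2 ^ (n - j) * (q - 1) ^ (n - j) * q ^ (i + j - n)"
proof -
  have "supp_bound q i (n - j) \<le> supp_size n q f"
    using assms spectral_U_interval[of q j n f i] by (intro supp_size_uniform_ge) auto
  \<comment> \<open>The hypothesis \<open>i + j \<ge> n\<close> says \<open>n - j \<le> i\<close>,
    which selects the branch of \<open>supp_bound\<close> with these exponents.\<close>
  moreover have "min i (n - j) = n - j" "max i (n - j) - min i (n - j) = i + j - n"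
    using assms by auto
  ultimately show ?thesis
    by (simp add: supp_bound_def power_mult_distrib)
qed

end
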